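(* Let $k$ be a positive integer, let $\{f(n)\}$, $\{f^{\ast}(n)\}$ be $k$-periodic sequences of complex numbers, $A=\{f(n)\}$, $B=\{f^*(n)\}$, and for an integer $\gamma$ let $A_\gamma=\{f(\gamma n)\}$, $B_\gamma=\{f^*(\gamma n)\}$. Let $c$ and $d$ be coprime positive integers with $d\equiv0\pmod k$, and let $b$ be an integer with $bc\equiv-1\pmod d$. Then \begin{align*} &s(-c,d;A_{c},B_{-b})-s(d,c;B_{b},A_{c})\\ &=P_{1}(0,B_{-b})P_{1}(0,A_{-c})-\frac{d}{c}B_{0}(A)P_{2}(0,B_{b})-\frac{c}{d}B_{0}(B)P_{2}(0,A_{c})-\frac{1}{2dc}B_{0}(B)B_{2}(A). \end{align*}
   Context: $P_n(x)=B_n(x-[x])/n!$ where $B_n(x)$ are the Bernoulli polynomials and $[x]$ is the floor. For a $k$-periodic $C=\{g(n)\}$: $B_j(C)$ is defined by $\sum_{n=0}^{k-1}\frac{t g(n)e^{nt}}{e^{kt}-1}=\sum_{j\ge0}B_j(C)\frac{t^j}{j!}$; $B_0(C)=\frac1k\sum_{m=0}^{k-1}g(m)$; and $P_r(x,C)=k^{r-1}\sum_{m=0}^{k-1}g(-m)P_r\!\left(\frac{m+x}{k}\right)$ for $r\ge1$ (e.g. $P_1(x,B_{-b})=\sum_{m=0}^{k-1}f^*(bm)P_1(\frac{m+x}{k})$, $P_2(0,A_c)=k\sum_{m=0}^{k-1}f(-cm)P_2(\frac mk)$). For an integer $x$, a positive integer $y$ and $k$-periodic sequences $C=\{g(n)\}$,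 $D$: $s(x,y;C,D)=\sum_{n=1}^{yk}g(n)P_1\!\left(\frac{n}{yk}\right)P_1\!\left(\frac{xn}{y},D\right)$. Thus $s(d,c;B_b,A_c)=\sum_{n=1}^{ck}f^*(bn)P_1(\frac{n}{ck})P_1(\frac{dn}{c},A_c)$ and $s(-c,d;A_c,B_{-b})=\sum_{n=1}^{dk}f(cn)P_1(\frac{n}{dk})P_1(-\frac{cn}{d},B_{-b})$. *)

theory Defs
  imports "HOL-Computational_Algebra.Formal_Power_Series" "HOL-Number_Theory.Cong"
begin

text \<open>
  Both generating functions below are quotients of formal power series over a field whose
  denominator has subdegree 1. Division of formal power series cancels that factor against the
  one in the numerator, so the quotients are the usual Taylor series
  (the two multiplication lemmas confirm this).
\<close>

definition bernoulli_gen :: "real \<Rightarrow> real fps" where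
  "bernoulli_gen x = fps_X * fps_exp x / (fps_exp 1 - 1)"

definition bernoulli_poly :: "nat \<Rightarrow> real \<Rightarrow> real" where
  "bernoulli_poly n x = fact n * fps_nth (bernoulli_gen x) n"

text \<open>
  The right-continuous convention is used at integers: \<open>bernoulli_P 1\<close> takes the value
  \<open>- 1/2\<close> there, not 0.
\<close>

definition bernoulli_P :: "nat \<Rightarrow> real \<Rightarrow> real" where
  "bernoulli_P n x = bernoulli_poly n (x - of_int \<lfloor>x\<rfloor>) / fact n"

definition periodic_bernoulli_gen :: "int \<Rightarrow> (int \<Rightarrow> complex) \<Rightarrow> complex fps" where
  "periodic_bernoulli_gen k g =
     (\<Sum>n\<in>{0..<k}. fps_X * fps_const (g n) * fps_exp (of_int n) / (fps_exp (of_int k) - 1))"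

definition periodic_bernoulli_number :: "int \<Rightarrow> nat \<Rightarrow> (int \<Rightarrow> complex) \<Rightarrow> complex" where
  "periodic_bernoulli_number k j g = fact j * fps_nth (periodic_bernoulli_gen k g) j"

text \<open>Intended for \<open>r \<ge> 1\<close> only; note the sign in \<open>g (- m)\<close>.\<close>

definition periodic_P :: "int \<Rightarrow> nat \<Rightarrow> real \<Rightarrow> (int \<Rightarrow> complex) \<Rightarrow> complex" where
  "periodic_P k r x g =
     of_int k ^ (r - 1) * (\<Sum>m\<in>{0..<k}. g (- m) * of_real (bernoulli_P r ((of_int m + x) / of_int k)))"

definition periodic_dedekind_sum ::
    "int \<Rightarrow> int \<Rightarrow> int \<Rightarrow> (int \<Rightarrow> complex) \<Rightarrow> (int \<Rightarrow> complex) \<Rightarrow> complex" where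
  "periodic_dedekind_sum k x y g h =
     (\<Sum>n\<in>{1..y * k}. g n * of_real (bernoulli_P 1 (of_int n / of_int (y * k)))
                        * periodic_P k 1 (of_int (x * n) / of_int y) h)"

definition dilate :: "(int \<Rightarrow> complex) \<Rightarrow> int \<Rightarrow> int \<Rightarrow> complex" where
  "dilate g \<gamma> = (\<lambda>n. g (\<gamma> * n))"

lemma fps_exp_quotient_mult:
  fixes a :: "'a :: field_char_0" and F :: "'a fps"
  assumes "a \<noteq> 0"
  shows "fps_X * F / (fps_exp a - 1) * (fps_exp a - 1) = fps_X * F"
proof -
  have nz: "fps_nth (fps_exp a - 1) 1 \<noteq> 0" using assms by simp
  hence ne: "fps_exp a - 1 \<noteq> 0" by (metis fps_zero_nth)
  have "subdegree (fps_exp a - 1) = 1"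
    by (rule subdegreeI) (use nz in auto)
  moreover have "subdegree (fps_X * F) \<ge> 1" if "F \<noteq> 0"
    using that by (simp add: subdegree_mult)
  ultimately have "(fps_exp a - 1) dvd fps_X * F"
    using ne by (cases "F = 0") (auto simp: fps_dvd_iff)
  thus ?thesis by (rule dvd_div_mult_self)
qed

lemma bernoulli_gen_mult:
  "bernoulli_gen x * (fps_exp 1 - 1) = fps_X * fps_exp x"
  unfolding bernoulli_gen_def by (rule fps_exp_quotient_mult) simp

lemma periodic_bernoulli_gen_mult:
  assumes "k > 0"
  shows "periodic_bernoulli_gen k g * (fps_exp (of_int k) - 1) =
           (\<Sum>n\<in>{0..<k}. fps_X * fps_const (g n) * fps_exp (of_int n))"
  using assms unfolding periodic_bernoulli_gen_def sum_distrib_right mult.assoc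
  by (intro sum.cong refl fps_exp_quotient_mult[unfolded mult.assoc]) simp

end

theory Submission
  imports Defs
begin

text \<open>
  Both sides are bilinear in the values \<open>f (c * r)\<close> and \<open>fstar (b * m)\<close>, so it suffices to compare
  coefficients. With \<open>x = r / k\<close> and \<open>y = m / k\<close> this is Rademacher's three-term reciprocity law
  for shifted Dedekind sums; since \<open>k\<close> divides \<open>d\<close>, the shift \<open>d * y\<close> in its last term is an
  integer and drops out. For the points \<open>X n = (n + x) / d\<close> and \<open>Y l = (l + y) / c\<close> of the unit interval,
  each floor in a Dedekind sum counts the points of one family below a point of the other, so the
  two sums combine into the sum of all \<open>max (X n) (Y l)\<close>. This reduces to the sum of
  \<open>\<bar>X n - Y l\<bar>\<close>, and \<open>\<bar>t\<bar> = t\<^sup>2 + 1 / 6 - 2 * P\<^sub>2 t\<close> for \<open>\<bar>t\<bar> < 1\<close> turns it into power sums and a sum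
  of \<open>P\<^sub>2\<close> evaluated by the distribution relation.
\<close>

section \<open>Sums of periodic functions over a period\<close>

lemma periodic_mult:
  fixes h :: "int \<Rightarrow> 'a"
  assumes "\<And>n. h (n + k) = h n"
  shows "h (n + k * j) = h n"
proof -
  have nat: "h (n + k * int i) = h n" for n i
  proof (induction i)
    case (Suc i)
    have "h (n + k * int (Suc i)) = h ((n + k * int i) + k)" by (simp add: algebra_simps)
    with Suc assms show ?case by simp
  qed simp
  show ?thesis
  proof (cases "j \<ge> 0")
    case True
    with nat[of n "nat j"] show ?thesis by simp
  next
    case False
    with nat[of "n + k * j" "nat (- j)"] show ?thesis by simp
  qed
qed

lemma periodic_cong:
  fixes h :: "int \<Rightarrow> 'a"
  assumes "\<And>n. h (n + k) = h n" and "[m = n] (mod k)"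
  shows "h m = h n"
proof -
  obtain j where "n = m + k * j" using assms(2) by (auto simp: cong_iff_lin)
  with periodic_mult[of h, OF assms(1)] show ?thesis by simp
qed

text \<open>An affine map with multiplier coprime to \<open>k\<close> permutes the residues modulo
  \<open>k\<close>. Later uses include \<open>a = - 1\<close> for reflections, dilations by
  \<open>b\<close> and \<open>c\<close>, and \<open>q = 1\<close> for shifting the range of
  summation.\<close>

lemma sum_periodic_affine:
  fixes h :: "int \<Rightarrow> 'a :: comm_monoid_add"
  assumes per: "\<And>n. h (n + k) = h n" and "k > 0" and "coprime a k"
  shows "(\<Sum>n\<in>{0..<k}. h (a * n + q)) = (\<Sum>n\<in>{0..<k}. h n)"
proof -
  let ?\<phi> = "\<lambda>n. (a * n + q) mod k"
  have "inj_on ?\<phi> {0..<k}"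
  proof (rule inj_onI)
    fix m n assume mn: "m \<in> {0..<k}" "n \<in> {0..<k}" and "?\<phi> m = ?\<phi> n"
    hence "[a * m + q = a * n + q] (mod k)" by (simp add: cong_def)
    hence "[m = n] (mod k)"
      using assms(3) by (simp add: cong_add_rcancel cong_mult_lcancel)
    thus "m = n" using mn by (simp add: cong_def)
  qed
  moreover have "?\<phi> ` {0..<k} \<subseteq> {0..<k}" using assms(2) by auto
  ultimately have bij: "bij_betw ?\<phi> {0..<k} {0..<k}"
    by (simp add: bij_betw_def endo_inj_surj)
  have "h (a * n + q) = h (?\<phi> n)" for n
    by (rule periodic_cong[of h, OF per]) (simp add: cong_def)
  hence "(\<Sum>n\<in>{0..<k}. h (a * n + q)) = (\<Sum>n\<in>{0..<k}. h (?\<phi> n))" by simp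
  also have "\<dots> = (\<Sum>n\<in>{0..<k}. h n)" by (rule sum.reindex_bij_betw[OF bij])
  finally show ?thesis .
qed

text \<open>Division with remainder by \<open>k\<close>. Periodicity first moves the range so that
  it starts at 0, where quotients and remainders fill a rectangle.\<close>

lemma sum_split_residues:
  fixes h :: "int \<Rightarrow> 'a :: comm_monoid_add"
  assumes per: "\<And>n. h (n + N * k) = h n" and "N > 0" and "k > 0"
  shows "(\<Sum>n\<in>{1..N * k}. h n) = (\<Sum>r\<in>{0..<k}. \<Sum>j\<in>{0..<N}. h (r + k * j))"
proof -
  have pos: "N * k > 0" using assms by simp
  have "(\<Sum>n\<in>{1..N * k}. h n) = (\<Sum>n\<in>{0..<N * k}. h (1 * n + 1))"
    by (rule sum.reindex_bij_witness[of _ "\<lambda>n. n + 1" "\<lambda>n. n - 1"]) auto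
  also have "\<dots> = (\<Sum>n\<in>{0..<N * k}. h n)"
    by (rule sum_periodic_affine[of h, OF per pos]) simp
  also have "\<dots> = (\<Sum>(r, j)\<in>{0..<k} \<times> {0..<N}. h (r + k * j))"
  proof (rule sum.reindex_bij_witness[of _ "\<lambda>(r, j). r + k * j" "\<lambda>n. (n mod k, n div k)"])
    fix n assume n: "n \<in> {0..<N * k}"
    hence "k * (n div k) < k * N"
      using mult_div_mod_eq[of k n] pos_mod_sign[OF assms(3), of n]
      by (simp only: atLeastLessThan_iff mult.commute[of N]) linarith
    hence "n div k < N" using assms(3) by simp
    thus "(n mod k, n div k) \<in> {0..<k} \<times> {0..<N}"
      using n assms(3) by (simp add: pos_imp_zdiv_nonneg_iff)
  next
    fix p assume "p \<in> {0..<k} \<times> {0..<N}"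
    then obtain r j where p: "p = (r, j)" "0 \<le> r" "r < k" "0 \<le> j" "j < N" by auto
    have "k * (j + 1) \<le> k * N" using p assms(3) by (intro mult_left_mono) auto
    hence "r + k * j < N * k" using p by (simp add: algebra_simps)
    thus "(case p of (r, j) \<Rightarrow> r + k * j) \<in> {0..<N * k}" using p assms(3) by simp
  qed (auto simp: assms)
  also have "\<dots> = (\<Sum>r\<in>{0..<k}. \<Sum>j\<in>{0..<N}. h (r + k * j))"
    by (simp add: sum.cartesian_product)
  finally show ?thesis .
qed

section \<open>The first Bernoulli polynomials and numbers\<close>

text \<open>The coefficients of orders 1, 2, 3 in the product form of the generating function
  determine its coefficients of orders 0, 1, 2 in turn.\<close>

lemma bernoulli_poly_1: "bernoulli_poly 1 x = x - 1 / 2"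
  and bernoulli_poly_2: "bernoulli_poly 2 x = x\<^sup>2 - x + 1 / 6"
proof -
  let ?G = "bernoulli_gen x"
  have eq: "fps_nth (?G * (fps_exp 1 - 1)) n = fps_nth (fps_X * fps_exp x) n" for n
    by (simp only: bernoulli_gen_mult)
  have 0: "fps_nth ?G 0 = 1"
    using eq[of 1] by (simp add: fps_mult_nth)
  have 1: "fps_nth ?G 1 = x - 1 / 2"
    using eq[of 2] 0 by (simp add: fps_mult_nth numeral_2_eq_2)
  have 2: "2 * fps_nth ?G 2 = x\<^sup>2 - x + 1 / 6"
    using eq[of 3] 0 1
    by (simp add: fps_mult_nth eval_nat_numeral fact_numeral field_simps)
  show "bernoulli_poly 1 x = x - 1 / 2"
    using 1 by (simp add: bernoulli_poly_def)
  show "bernoulli_poly 2 x = x\<^sup>2 - x + 1 / 6"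
    using 2 by (simp add: bernoulli_poly_def)
qed

text \<open>Comparing coefficients gives a triangular system whose right-hand sides are the moments
  \<open>?M i\<close>. Expanding the quadratic Bernoulli polynomial at \<open>n / k\<close> gives
  the combination of moments that isolates order 2.\<close>

lemma periodic_bernoulli_number_0:
  assumes "k > 0"
  shows "of_int k * periodic_bernoulli_number k 0 g = (\<Sum>n\<in>{0..<k}. g n)"
    and periodic_bernoulli_number_2:
      "periodic_bernoulli_number k 2 g =
         of_int k * (\<Sum>n\<in>{0..<k}. g n * of_real (bernoulli_poly 2 (of_int n / of_int k)))"
proof -
  let ?G = "periodic_bernoulli_gen k g"
  let ?S = "\<Sum>n\<in>{0..<k}. fps_X * fps_const (g n) * fps_exp (of_int n)"
  let ?M = "\<lambda>i. \<Sum>n\<in>{0..<k}. g n * of_int n ^ i"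
  have eq: "fps_nth (?G * (fps_exp (of_int k) - 1)) n = fps_nth ?S n" for n
    by (simp only: periodic_bernoulli_gen_mult[OF assms])
  have S: "fps_nth ?S (Suc i) = ?M i / fact i" for i
    by (simp add: fps_sum_nth mult.assoc sum_divide_distrib)
  have 0: "of_int k * fps_nth ?G 0 = ?M 0"
    using eq[of 1] S[of 0] by (simp add: fps_mult_nth mult.commute)
  have 1: "of_int k * fps_nth ?G 1 + of_int k ^ 2 / 2 * fps_nth ?G 0 = ?M 1"
    using eq[of 2] S[of 1] by (simp add: fps_mult_nth numeral_2_eq_2 algebra_simps)
  have 2: "of_int k * fps_nth ?G 2 + of_int k ^ 2 / 2 * fps_nth ?G 1
             + of_int k ^ 3 / 6 * fps_nth ?G 0 = ?M 2 / 2"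
    using eq[of 3] S[of 2] by (simp add: fps_mult_nth eval_nat_numeral fact_numeral algebra_simps)
  show "of_int k * periodic_bernoulli_number k 0 g = (\<Sum>n\<in>{0..<k}. g n)"
    using 0 by (simp add: periodic_bernoulli_number_def)
  have k: "of_int k \<noteq> (0 :: complex)" using assms by simp
  have "(\<Sum>n\<in>{0..<k}. g n * of_real (bernoulli_poly 2 (of_int n / of_int k)))
      = (\<Sum>n\<in>{0..<k}. g n * of_int n ^ 2 * (1 / of_int k ^ 2) - g n * of_int n * (1 / of_int k)
           + g n * (1 / 6))"
    by (intro sum.cong) (simp_all add: bernoulli_poly_2 power_divide algebra_simps)
  also have "\<dots> = ?M 2 * (1 / of_int k ^ 2) - ?M 1 * (1 / of_int k) + ?M 0 * (1 / 6)"
    by (simp only: sum.distrib sum_subtractf sum_distrib_right power_one_right power_0 mult_1_right)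
  finally have R: "(\<Sum>n\<in>{0..<k}. g n * of_real (bernoulli_poly 2 (of_int n / of_int k)))
      = ?M 2 * (1 / of_int k ^ 2) - ?M 1 * (1 / of_int k) + ?M 0 * (1 / 6)" .
  have M2: "?M 2 = 2 * (of_int k * fps_nth ?G 2 + of_int k ^ 2 / 2 * fps_nth ?G 1
             + of_int k ^ 3 / 6 * fps_nth ?G 0)"
    unfolding 2 by simp
  have "periodic_bernoulli_number k 2 g = 2 * fps_nth ?G 2"
    by (simp add: periodic_bernoulli_number_def)
  also have "\<dots> = of_int k * (?M 2 * (1 / of_int k ^ 2) - ?M 1 * (1 / of_int k) + ?M 0 * (1 / 6))"
    unfolding M2 0[symmetric] 1[symmetric] using k
    by (simp add: field_simps power2_eq_square power3_eq_cube)
  finally show "periodic_bernoulli_number k 2 g =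
         of_int k * (\<Sum>n\<in>{0..<k}. g n * of_real (bernoulli_poly 2 (of_int n / of_int k)))"
    unfolding R .
qed

section \<open>The periodic functions P_1 and P_2\<close>

lemma bernoulli_P_shift [simp]: "bernoulli_P n (x + of_int j) = bernoulli_P n x"
  by (simp add: bernoulli_P_def)

text \<open>Takes the integer shift as an explicit \<open>j\<close>, for arguments in which it is
  not visible syntactically.\<close>

lemma bernoulli_P_eq:
  assumes "x = y + of_int j"
  shows "bernoulli_P n x = bernoulli_P n y"
  using assms by simp

lemma bernoulli_P_1: "bernoulli_P 1 x = x - of_int \<lfloor>x\<rfloor> - 1 / 2"
  unfolding bernoulli_P_def bernoulli_poly_1 by simp

lemma bernoulli_P_2_unit:
  assumes "0 \<le> x" "x < 1"
  shows "2 * bernoulli_P 2 x = x\<^sup>2 - x + 1 / 6"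
proof -
  have "\<lfloor>x\<rfloor> = 0" using assms by (simp add: floor_eq_iff)
  thus ?thesis by (simp add: bernoulli_P_def bernoulli_poly_2)
qed

text \<open>For negative \<open>x\<close> the period moves the argument to \<open>x + 1\<close> in
  the unit interval, and the Bernoulli polynomial there is x^2 + x + 1/6.\<close>

lemma bernoulli_P_2_abs:
  assumes "\<bar>x\<bar> < 1"
  shows "2 * bernoulli_P 2 x = x\<^sup>2 - \<bar>x\<bar> + 1 / 6"
proof (cases "x \<ge> 0")
  case True
  thus ?thesis using assms bernoulli_P_2_unit[of x] by simp
next
  case False
  hence "2 * bernoulli_P 2 (x + of_int 1) = (x + 1)\<^sup>2 - (x + 1) + 1 / 6"
    using assms bernoulli_P_2_unit[of "x + 1"] by simp
  thus ?thesis using False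
    by (simp only: bernoulli_P_shift) (simp add: power2_eq_square algebra_simps)
qed

text \<open>The formula of \<open>bernoulli_P_2_abs\<close> is even and covers both
  \<open>frac x\<close> and \<open>- frac x\<close>.\<close>

lemma bernoulli_P_2_minus: "bernoulli_P 2 (- x) = bernoulli_P 2 x"
proof -
  have "2 * bernoulli_P 2 (- frac x) = 2 * bernoulli_P 2 (frac x)"
    using frac_ge_0[of x] frac_lt_1[of x] by (simp add: bernoulli_P_2_abs)
  moreover have "bernoulli_P 2 (- x) = bernoulli_P 2 (- frac x)"
    by (rule bernoulli_P_eq[where j = "- \<lfloor>x\<rfloor>"]) (simp add: frac_def)
  moreover have "bernoulli_P 2 x = bernoulli_P 2 (frac x)"
    by (rule bernoulli_P_eq[where j = "\<lfloor>x\<rfloor>"]) (simp add: frac_def)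
  ultimately show ?thesis by simp
qed

section \<open>Power sums and the distribution relation for P_2\<close>

lemma sum_int_range:
  assumes "n \<ge> 0"
  shows "(\<Sum>j\<in>{0..<n}. real_of_int j) = of_int n * (of_int n - 1) / 2"
    and "(\<Sum>j\<in>{0..<n}. (real_of_int j)\<^sup>2) = of_int n * (of_int n - 1) * (2 * of_int n - 1) / 6"
proof -
  have "(\<Sum>j\<in>{0..<int m}. real_of_int j) = real m * (real m - 1) / 2 \<and>
        (\<Sum>j\<in>{0..<int m}. (real_of_int j)\<^sup>2) = real m * (real m - 1) * (2 * real m - 1) / 6" for m
  proof (induction m)
    case (Suc m)
    have "{0..<int (Suc m)} = insert (int m) {0..<int m}" by auto
    with Suc show ?case by (simp add: field_simps power2_eq_square)
  qed simp
  from this[of "nat n"] assms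
  show "(\<Sum>j\<in>{0..<n}. real_of_int j) = of_int n * (of_int n - 1) / 2"
    and "(\<Sum>j\<in>{0..<n}. (real_of_int j)\<^sup>2) = of_int n * (of_int n - 1) * (2 * of_int n - 1) / 6"
    by simp_all
qed

lemma sum_shifted_points:
  fixes x :: real
  assumes "d > 0"
  shows "(\<Sum>n\<in>{0..<d}. (of_int n + x) / of_int d) = (of_int d - 1) / 2 + x"
    and "(\<Sum>n\<in>{0..<d}. ((of_int n + x) / of_int d)\<^sup>2) =
           ((of_int d - 1) * (2 * of_int d - 1) / 6 + x * (of_int d - 1) + x\<^sup>2) / of_int d"
proof -
  have d: "real_of_int d > 0" using assms by simp
  have "(\<Sum>n\<in>{0..<d}. (of_int n + x) / of_int d) = ((\<Sum>n\<in>{0..<d}. of_int n) + of_int d * x) / of_int d"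
    using assms by (simp add: sum.distrib flip: sum_divide_distrib)
  also have "\<dots> = (of_int d - 1) / 2 + x"
    using assms d by (simp add: sum_int_range field_simps)
  finally show "(\<Sum>n\<in>{0..<d}. (of_int n + x) / of_int d) = (of_int d - 1) / 2 + x" .
  have "(\<Sum>n\<in>{0..<d}. ((of_int n + x) / of_int d)\<^sup>2) =
      ((\<Sum>n\<in>{0..<d}. (of_int n)\<^sup>2) + (\<Sum>n\<in>{0..<d}. of_int n) * (2 * x) + of_int d * x\<^sup>2) / (of_int d)\<^sup>2"
    using assms
    by (simp add: power_divide power2_sum sum.distrib sum_distrib_right mult.assoc
        mult.left_commute[of 2] flip: sum_divide_distrib)
  also have "\<dots> = ((of_int d - 1) * (2 * of_int d - 1) / 6 + x * (of_int d - 1) + x\<^sup>2) / of_int d"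
    unfolding sum_int_range[OF less_imp_le[OF assms]] using d
    by (simp add: field_simps power2_eq_square)
  finally show "(\<Sum>n\<in>{0..<d}. ((of_int n + x) / of_int d)\<^sup>2) =
           ((of_int d - 1) * (2 * of_int d - 1) / 6 + x * (of_int d - 1) + x\<^sup>2) / of_int d" .
qed

text \<open>Since \<open>a\<close> is invertible modulo \<open>N\<close>, the integers
  \<open>a * j + \<lfloor>w\<rfloor>\<close> run through all residues. This leaves the equally
  spaced points \<open>(j + t) / N\<close> of the unit interval, where P_2 is a polynomial and power
  sums suffice.\<close>

lemma bernoulli_P_2_distribution:
  assumes "N > 0" and "coprime a N"
  shows "(\<Sum>j\<in>{0..<N}. bernoulli_P 2 ((w + of_int (a * j)) / of_int N)) = bernoulli_P 2 w / of_int N"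
proof -
  have N: "real_of_int N > 0" using assms by simp
  define t where "t = frac w"
  define h where "h = (\<lambda>j. bernoulli_P 2 ((of_int j + t) / of_int N))"
  have t: "0 \<le> t" "t < 1" by (simp_all add: t_def frac_lt_1)
  have per: "h (j + N) = h j" for j
    unfolding h_def by (rule bernoulli_P_eq[where j = 1]) (use N in \<open>simp add: field_simps\<close>)
  have "(w + of_int (a * j)) / of_int N = (of_int (a * j + \<lfloor>w\<rfloor>) + t) / of_int N" for j
    by (simp add: t_def frac_def)
  hence "(\<Sum>j\<in>{0..<N}. bernoulli_P 2 ((w + of_int (a * j)) / of_int N))
       = (\<Sum>j\<in>{0..<N}. h (a * j + \<lfloor>w\<rfloor>))"
    by (simp only: h_def)
  also have "\<dots> = (\<Sum>j\<in>{0..<N}. h j)"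
    by (rule sum_periodic_affine[of h, OF per assms])
  also have "2 * \<dots> = (\<Sum>j\<in>{0..<N}. ((of_int j + t) / of_int N)\<^sup>2 - (of_int j + t) / of_int N + 1 / 6)"
    unfolding sum_distrib_left
  proof (rule sum.cong)
    fix j assume j: "j \<in> {0..<N}"
    hence "real_of_int (j + 1) \<le> of_int N" by (simp only: of_int_le_iff) auto
    hence "(of_int j + t) / of_int N < 1" using t N by (simp add: divide_less_eq)
    moreover have "(of_int j + t) / of_int N \<ge> 0" using t j N by simp
    ultimately show "2 * h j = ((of_int j + t) / of_int N)\<^sup>2 - (of_int j + t) / of_int N + 1 / 6"
      unfolding h_def by (intro bernoulli_P_2_unit)
  qed simp
  also have "\<dots> = ((of_int N - 1) * (2 * of_int N - 1) / 6 + t * (of_int N - 1) + t\<^sup>2) / of_int N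
      - ((of_int N - 1) / 2 + t) + of_int N / 6"
    using assms sum_shifted_points[OF assms(1), of t] by (simp add: sum.distrib sum_subtractf)
  also have "\<dots> = (t\<^sup>2 - t + 1 / 6) / of_int N"
    using N by (simp add: field_simps power2_eq_square)
  also have "\<dots> = 2 * (bernoulli_P 2 t / of_int N)"
    using bernoulli_P_2_unit[OF t] by simp
  also have "bernoulli_P 2 t = bernoulli_P 2 w"
    by (rule bernoulli_P_eq[where j = "- \<lfloor>w\<rfloor>"]) (simp add: t_def frac_def)
  finally show ?thesis by simp
qed

section \<open>Rademacher's reciprocity law\<close>

text \<open>Two applications of the distribution relation: multiplier -1 modulo \<open>c\<close> for
  the inner sum, multiplier \<open>c\<close> modulo \<open>d\<close> for the outer one.\<close>

lemma bernoulli_P_2_lattice_sum: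
  assumes "c > 0" "d > 0" "coprime c d"
  shows "(\<Sum>n\<in>{0..<d}. \<Sum>l\<in>{0..<c}.
            bernoulli_P 2 ((of_int n + x) / of_int d - (of_int l + y) / of_int c))
         = bernoulli_P 2 (of_int c * x - of_int d * y) / (of_int c * of_int d)"
proof -
  have cd: "real_of_int c > 0" "real_of_int d > 0" using assms by simp_all
  have inner: "(\<Sum>l\<in>{0..<c}. bernoulli_P 2 ((of_int n + x) / of_int d - (of_int l + y) / of_int c))
      = bernoulli_P 2 ((of_int c * x - of_int d * y + of_int (c * n)) / of_int d) / of_int c" for n
  proof -
    \<comment> \<open>This is \<open>c * X - y\<close> for X = \<open>(n + x) / d\<close>, so the
      difference of the two points is \<open>(?w - l) / c\<close>.\<close>
    let ?w = "(of_int c * x - of_int d * y + of_int (c * n)) / real_of_int d"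
    have "(of_int n + x) / of_int d - (of_int l + y) / of_int c = (?w + of_int (- 1 * l)) / of_int c" for l
      using cd by (simp add: divide_simps) (simp add: algebra_simps)
    moreover have "coprime (- 1) c" by simp
    ultimately show ?thesis
      using bernoulli_P_2_distribution[OF assms(1), of "- 1" ?w] by (simp only:)
  qed
  have "(\<Sum>n\<in>{0..<d}. \<Sum>l\<in>{0..<c}.
            bernoulli_P 2 ((of_int n + x) / of_int d - (of_int l + y) / of_int c))
      = bernoulli_P 2 (of_int c * x - of_int d * y) / of_int d / of_int c"
    unfolding inner sum_divide_distrib[symmetric]
      bernoulli_P_2_distribution[OF assms(2,3), of "of_int c * x - of_int d * y"] ..
  thus ?thesis by (simp only: divide_divide_eq_left mult.commute)
qed

text \<open>The floor equals minus the ceiling \<open>q\<close> of \<open>c * X - y\<close>, and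
  \<open>q\<close> counts the indices \<open>l\<close> with \<open>l < q\<close>. The ceiling is
  what makes the comparison strict.\<close>

lemma bernoulli_P_1_count_less:
  assumes "c > 0" "0 \<le> X" "X < 1" "0 \<le> y" "y < 1"
  shows "bernoulli_P 1 (y - of_int c * X) =
           y - of_int c * X - 1 / 2 + (\<Sum>l\<in>{0..<c}. if (of_int l + y) / of_int c < X then 1 else 0)"
proof -
  have c: "real_of_int c > 0" using assms by simp
  define q where "q = \<lceil>of_int c * X - y\<rceil>"
  have cX: "0 \<le> of_int c * X" "of_int c * X < of_int c" using assms c by simp_all
  have "q \<ge> 0" unfolding q_def zero_le_ceiling using cX assms by linarith
  have "q \<le> c" unfolding q_def ceiling_le_iff using cX assms by linarith
  have less: "(of_int l + y) / of_int c < X \<longleftrightarrow> l < q" for l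
    unfolding q_def less_ceiling_iff using c by (simp add: pos_divide_less_eq less_diff_eq mult.commute)
  have "{0..<c} \<inter> {l. l < q} = {0..<q}" using \<open>q \<le> c\<close> by auto
  hence "(\<Sum>l\<in>{0..<c}. if (of_int l + y) / of_int c < X then 1 else 0) = real_of_int q"
    unfolding less using \<open>q \<ge> 0\<close> by (simp add: sum.If_cases)
  moreover have "\<lfloor>y - of_int c * X\<rfloor> = - q"
    by (simp add: q_def ceiling_def)
  ultimately show ?thesis unfolding bernoulli_P_1 by simp
qed

text \<open>Here the floor \<open>q\<close> itself bounds the indices, so the comparison is not
  strict. Counting from 0 to \<open>q\<close> gives \<open>q + 1\<close> points, hence
  \<open>+ 1 / 2\<close>; for \<open>q = - 1\<close> no point is counted.\<close>

lemma bernoulli_P_1_count_le: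
  assumes "d > 0" "0 \<le> Y" "Y < 1" "0 \<le> x" "x < 1"
  shows "bernoulli_P 1 (of_int d * Y - x) =
           of_int d * Y - x + 1 / 2 - (\<Sum>n\<in>{0..<d}. if (of_int n + x) / of_int d \<le> Y then 1 else 0)"
proof -
  have d: "real_of_int d > 0" using assms by simp
  define q where "q = \<lfloor>of_int d * Y - x\<rfloor>"
  have dY: "0 \<le> of_int d * Y" "of_int d * Y < of_int d" using assms d by simp_all
  have "- 1 \<le> q" unfolding q_def le_floor_iff using dY assms by linarith
  have "q < d" unfolding q_def floor_less_iff using dY assms by linarith
  have le: "(of_int n + x) / of_int d \<le> Y \<longleftrightarrow> n \<le> q" for n
    unfolding q_def le_floor_iff using d by (simp add: pos_divide_le_eq le_diff_eq mult.commute)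
  have "{0..<d} \<inter> {n. n \<le> q} = {0..q}" using \<open>q < d\<close> by auto
  hence "(\<Sum>n\<in>{0..<d}. if (of_int n + x) / of_int d \<le> Y then 1 else 0) = real_of_int (q + 1)"
    unfolding le using \<open>- 1 \<le> q\<close> by (simp add: sum.If_cases)
  thus ?thesis unfolding bernoulli_P_1 q_def by simp
qed

lemma shifted_point_unit:
  fixes x :: real
  assumes "n \<in> {0..<d}" "0 \<le> x" "x < 1"
  shows "0 \<le> (of_int n + x) / of_int d" "(of_int n + x) / of_int d < 1"
proof -
  have "real_of_int (n + 1) \<le> of_int d" using assms(1) by (simp only: of_int_le_iff) auto
  thus "(of_int n + x) / of_int d < 1" "0 \<le> (of_int n + x) / of_int d"
    using assms by (simp_all add: divide_less_eq)
qed

lemma bernoulli_P_1_unit: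
  assumes "0 \<le> x" "x < 1"
  shows "bernoulli_P 1 x = x - 1 / 2"
proof -
  have "\<lfloor>x\<rfloor> = 0" using assms by (simp add: floor_eq_iff)
  thus ?thesis unfolding bernoulli_P_1 by simp
qed

text \<open>The strict and the non-strict count are complementary, so every pair
  \<open>(n, l)\<close> is met exactly once. Coinciding points therefore need no correction term
  under the right-continuous convention.\<close>

lemma bernoulli_P_1_reciprocity:
  assumes "c > 0" "d > 0" "coprime c d" "0 \<le> x" "x < 1" "0 \<le> y" "y < 1"
  shows "(\<Sum>n\<in>{0..<d}. bernoulli_P 1 ((of_int n + x) / of_int d)
              * bernoulli_P 1 (y - of_int c * ((of_int n + x) / of_int d)))
         - (\<Sum>l\<in>{0..<c}. bernoulli_P 1 ((of_int l + y) / of_int c)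
              * bernoulli_P 1 (of_int d * ((of_int l + y) / of_int c) - x))
         = bernoulli_P 1 x * bernoulli_P 1 y
           - of_int d / of_int c * bernoulli_P 2 y - of_int c / of_int d * bernoulli_P 2 x
           - 1 / (of_int c * of_int d) * bernoulli_P 2 (of_int c * x - of_int d * y)"
proof -
  have cd: "real_of_int c > 0" "real_of_int d > 0" using assms by simp_all
  define X where "X = (\<lambda>n::int. (of_int n + x) / of_int d)"
  define Y where "Y = (\<lambda>l::int. (of_int l + y) / of_int c)"
  \<comment> \<open>Pointwise equations, used to fold instances of the counting lemmas back into
    \<open>X\<close> and \<open>Y\<close>.\<close>
  have X_eq: "X n = (of_int n + x) / of_int d" for n by (simp add: X_def)
  have Y_eq: "Y l = (of_int l + y) / of_int c" for l by (simp add: Y_def)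
  have X: "0 \<le> X n" "X n < 1" if "n \<in> {0..<d}" for n
    using shifted_point_unit[OF that assms(4,5)] by (simp_all add: X_def)
  have Y: "0 \<le> Y l" "Y l < 1" if "l \<in> {0..<c}" for l
    using shifted_point_unit[OF that assms(6,7)] by (simp_all add: Y_def)
  \<comment> \<open>The moments stay opaque until the final computation, where their closed forms
    are inserted.\<close>
  define SX where "SX = (\<Sum>n\<in>{0..<d}. X n)"
  define SXX where "SXX = (\<Sum>n\<in>{0..<d}. (X n)\<^sup>2)"
  define SY where "SY = (\<Sum>l\<in>{0..<c}. Y l)"
  define SYY where "SYY = (\<Sum>l\<in>{0..<c}. (Y l)\<^sup>2)"
  define Z where "Z = bernoulli_P 2 (of_int c * x - of_int d * y)"
  \<comment> \<open>Separates a quadratic polynomial in \<open>X n\<close> from the counting part,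
    with the factor \<open>X n - 1 / 2\<close> moved into the count.\<close>
  have A: "(\<Sum>n\<in>{0..<d}. bernoulli_P 1 (X n) * bernoulli_P 1 (y - of_int c * X n))
     = (\<Sum>n\<in>{0..<d}. X n * (y - 1 / 2 + of_int c / 2) - of_int c * (X n)\<^sup>2 - (y - 1 / 2) / 2)
       + (\<Sum>n\<in>{0..<d}. \<Sum>l\<in>{0..<c}. if Y l < X n then X n - 1 / 2 else 0)"
    unfolding sum.distrib[symmetric]
  proof (rule sum.cong)
    fix n assume n: "n \<in> {0..<d}"
    have "bernoulli_P 1 (X n) * bernoulli_P 1 (y - of_int c * X n) =
        (X n - 1 / 2) * (y - of_int c * X n - 1 / 2) +
        (X n - 1 / 2) * (\<Sum>l\<in>{0..<c}. if Y l < X n then 1 else 0)"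
      unfolding bernoulli_P_1_unit[OF X[OF n]]
        bernoulli_P_1_count_less[OF assms(1) X[OF n] assms(6,7), folded Y_eq]
      by (rule distrib_left)
    also have "(X n - 1 / 2) * (\<Sum>l\<in>{0..<c}. if Y l < X n then 1 else 0)
        = (\<Sum>l\<in>{0..<c}. if Y l < X n then X n - 1 / 2 else 0)"
      unfolding sum_distrib_left by (intro sum.cong) auto
    finally show "bernoulli_P 1 (X n) * bernoulli_P 1 (y - of_int c * X n) =
        X n * (y - 1 / 2 + of_int c / 2) - of_int c * (X n)\<^sup>2 - (y - 1 / 2) / 2 +
        (\<Sum>l\<in>{0..<c}. if Y l < X n then X n - 1 / 2 else 0)"
      by (simp add: diff_divide_distrib add_divide_distrib algebra_simps power2_eq_square)
  qed simp
  have B: "(\<Sum>l\<in>{0..<c}. bernoulli_P 1 (Y l) * bernoulli_P 1 (of_int d * Y l - x))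
     = (\<Sum>l\<in>{0..<c}. of_int d * (Y l)\<^sup>2 + Y l * (1 / 2 - x - of_int d / 2) + (x - 1 / 2) / 2)
       - (\<Sum>l\<in>{0..<c}. \<Sum>n\<in>{0..<d}. if X n \<le> Y l then Y l - 1 / 2 else 0)"
    unfolding sum_subtractf[symmetric]
  proof (rule sum.cong)
    fix l assume l: "l \<in> {0..<c}"
    have "bernoulli_P 1 (Y l) * bernoulli_P 1 (of_int d * Y l - x) =
        (Y l - 1 / 2) * (of_int d * Y l - x + 1 / 2) -
        (Y l - 1 / 2) * (\<Sum>n\<in>{0..<d}. if X n \<le> Y l then 1 else 0)"
      unfolding bernoulli_P_1_unit[OF Y[OF l]]
        bernoulli_P_1_count_le[OF assms(2) Y[OF l] assms(4,5), folded X_eq]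
      by (rule right_diff_distrib)
    also have "(Y l - 1 / 2) * (\<Sum>n\<in>{0..<d}. if X n \<le> Y l then 1 else 0)
        = (\<Sum>n\<in>{0..<d}. if X n \<le> Y l then Y l - 1 / 2 else 0)"
      unfolding sum_distrib_left by (intro sum.cong) auto
    finally show "bernoulli_P 1 (Y l) * bernoulli_P 1 (of_int d * Y l - x) =
        of_int d * (Y l)\<^sup>2 + Y l * (1 / 2 - x - of_int d / 2) + (x - 1 / 2) / 2 -
        (\<Sum>n\<in>{0..<d}. if X n \<le> Y l then Y l - 1 / 2 else 0)"
      by (simp add: diff_divide_distrib add_divide_distrib algebra_simps power2_eq_square)
  qed simp
  \<comment> \<open>After exchanging the order of summation in the second sum, exactly one of the
    two conditions holds for each pair, and it selects the larger point.\<close>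
  have "(\<Sum>n\<in>{0..<d}. \<Sum>l\<in>{0..<c}. if Y l < X n then X n - 1 / 2 else 0)
      + (\<Sum>l\<in>{0..<c}. \<Sum>n\<in>{0..<d}. if X n \<le> Y l then Y l - 1 / 2 else 0)
     = (\<Sum>n\<in>{0..<d}. \<Sum>l\<in>{0..<c}. max (X n) (Y l) - 1 / 2)"
    unfolding sum.swap[of _ "{0..<d}" "{0..<c}"] sum.distrib[symmetric]
    by (intro sum.cong) (auto simp: max_def)
  also have "\<dots> = (\<Sum>n\<in>{0..<d}. \<Sum>l\<in>{0..<c}.
      X n / 2 + Y l / 2 + ((X n)\<^sup>2 + (Y l)\<^sup>2 - 2 * X n * Y l + 1 / 6) / 2 - 1 / 2
        - bernoulli_P 2 (X n - Y l))"
  proof (intro sum.cong refl)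
    fix n l assume nl: "n \<in> {0..<d}" "l \<in> {0..<c}"
    have "\<bar>X n - Y l\<bar> < 1" using X[OF nl(1)] Y[OF nl(2)] by (simp add: abs_if)
    from bernoulli_P_2_abs[OF this]
    have "\<bar>X n - Y l\<bar> = (X n)\<^sup>2 + (Y l)\<^sup>2 - 2 * X n * Y l + 1 / 6 - 2 * bernoulli_P 2 (X n - Y l)"
      by (simp add: power2_diff)
    moreover have "max (X n) (Y l) = (X n + Y l + \<bar>X n - Y l\<bar>) / 2"
      by (simp add: max_def abs_if)
    ultimately show "max (X n) (Y l) - 1 / 2 =
      X n / 2 + Y l / 2 + ((X n)\<^sup>2 + (Y l)\<^sup>2 - 2 * X n * Y l + 1 / 6) / 2 - 1 / 2
        - bernoulli_P 2 (X n - Y l)"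
      by (simp add: field_simps)
  qed
  also have "\<dots> = (\<Sum>n\<in>{0..<d}. of_int c * X n / 2 + SY / 2
        + (of_int c * (X n)\<^sup>2 + SYY - 2 * X n * SY + of_int c / 6) / 2 - of_int c / 2
        - (\<Sum>l\<in>{0..<c}. bernoulli_P 2 (X n - Y l)))"
    using assms(1)
    by (simp only: SY_def SYY_def sum.distrib sum_subtractf sum_constant
        sum_divide_distrib[symmetric] sum_distrib_left[symmetric]) simp
  \<comment> \<open>The mixed products factor as \<open>SX * SY\<close>, and the double sum of P_2
    is the lattice sum, which contributes \<open>Z\<close>.\<close>
  also have "\<dots> = of_int c * SX / 2 + of_int d * SY / 2
      + (of_int c * SXX + of_int d * SYY - 2 * SX * SY + of_int c * of_int d / 6) / 2
      - of_int c * of_int d / 2 - Z / (of_int c * of_int d)"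
    using assms(2) bernoulli_P_2_lattice_sum[OF assms(1-3), of x y]
    by (simp only: SX_def SXX_def X_eq[symmetric] Y_eq[symmetric] Z_def sum.distrib sum_subtractf sum_constant
        sum_divide_distrib[symmetric] sum_distrib_left[symmetric] sum_distrib_right[symmetric]) (simp add: mult.commute)
  finally have M: "(\<Sum>n\<in>{0..<d}. \<Sum>l\<in>{0..<c}. if Y l < X n then X n - 1 / 2 else 0)
      + (\<Sum>l\<in>{0..<c}. \<Sum>n\<in>{0..<d}. if X n \<le> Y l then Y l - 1 / 2 else 0)
     = of_int c * SX / 2 + of_int d * SY / 2
      + (of_int c * SXX + of_int d * SYY - 2 * SX * SY + of_int c * of_int d / 6) / 2
      - of_int c * of_int d / 2 - Z / (of_int c * of_int d)" .
  have A': "(\<Sum>n\<in>{0..<d}. X n * (y - 1 / 2 + of_int c / 2) - of_int c * (X n)\<^sup>2 - (y - 1 / 2) / 2)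
      = SX * (y - 1 / 2 + of_int c / 2) - of_int c * SXX - of_int d * ((y - 1 / 2) / 2)"
    using assms(2)
    by (simp only: SX_def SXX_def sum_subtractf sum_distrib_left sum_distrib_right sum_constant) simp
  have B': "(\<Sum>l\<in>{0..<c}. of_int d * (Y l)\<^sup>2 + Y l * (1 / 2 - x - of_int d / 2) + (x - 1 / 2) / 2)
      = of_int d * SYY + SY * (1 / 2 - x - of_int d / 2) + of_int c * ((x - 1 / 2) / 2)"
    using assms(1)
    by (simp only: SY_def SYY_def sum.distrib sum_distrib_left sum_distrib_right sum_constant) simp
  have SX: "SX = (of_int d - 1) / 2 + x"
    and SXX: "SXX = ((of_int d - 1) * (2 * of_int d - 1) / 6 + x * (of_int d - 1) + x\<^sup>2) / of_int d"
    using sum_shifted_points[OF assms(2), of x] by (simp_all add: SX_def SXX_def X_def)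
  have SY: "SY = (of_int c - 1) / 2 + y"
    and SYY: "SYY = ((of_int c - 1) * (2 * of_int c - 1) / 6 + y * (of_int c - 1) + y\<^sup>2) / of_int c"
    using sum_shifted_points[OF assms(1), of y] by (simp_all add: SY_def SYY_def Y_def)
  have P2: "bernoulli_P 2 x = (x\<^sup>2 - x + 1 / 6) / 2" "bernoulli_P 2 y = (y\<^sup>2 - y + 1 / 6) / 2"
    using bernoulli_P_2_unit[OF assms(4,5)] bernoulli_P_2_unit[OF assms(6,7)] by simp_all
  have "(\<Sum>n\<in>{0..<d}. bernoulli_P 1 (X n) * bernoulli_P 1 (y - of_int c * X n))
      - (\<Sum>l\<in>{0..<c}. bernoulli_P 1 (Y l) * bernoulli_P 1 (of_int d * Y l - x))
     = SX * (y - 1 / 2 + of_int c / 2) - of_int c * SXX - of_int d * ((y - 1 / 2) / 2)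
      - (of_int d * SYY + SY * (1 / 2 - x - of_int d / 2) + of_int c * ((x - 1 / 2) / 2))
      + (of_int c * SX / 2 + of_int d * SY / 2
      + (of_int c * SXX + of_int d * SYY - 2 * SX * SY + of_int c * of_int d / 6) / 2
      - of_int c * of_int d / 2 - Z / (of_int c * of_int d))"
    unfolding A B A' B' M[symmetric] by linarith
  \<comment> \<open>A rational identity in \<open>c\<close>, \<open>d\<close>, \<open>x\<close>,
    \<open>y\<close>; the term in \<open>Z\<close> is the same on both sides.\<close>
  also have "\<dots> = (x - 1 / 2) * (y - 1 / 2)
      - of_int d / of_int c * ((y\<^sup>2 - y + 1 / 6) / 2) - of_int c / of_int d * ((x\<^sup>2 - x + 1 / 6) / 2)
      - 1 / (of_int c * of_int d) * Z"
    unfolding SX SXX SY SYY using cd by (simp add: field_simps power2_eq_square)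
  finally show ?thesis
    unfolding P2[symmetric] bernoulli_P_1_unit[OF assms(4,5), symmetric]
      bernoulli_P_1_unit[OF assms(6,7), symmetric] Z_def X_def Y_def .
qed

section \<open>Twisted sums\<close>

lemma complex_bilinear_sum:
  fixes F G :: "int \<Rightarrow> complex" and p q :: "int \<Rightarrow> real"
  shows "(\<Sum>r\<in>S. \<Sum>m\<in>T. F r * G m * of_real (p r * q m)) =
           (\<Sum>r\<in>S. F r * of_real (p r)) * (\<Sum>m\<in>T. G m * of_real (q m))"
  by (simp add: sum_product mult_ac)

text \<open>Writing \<open>n = r + k * j\<close> and unfolding \<open>periodic_P\<close> isolates
  the coefficients \<open>g r * h (- m)\<close>. What multiplies them is a real Dedekind sum with
  shifts \<open>r / k\<close> and \<open>m / k\<close>.\<close>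

lemma periodic_dedekind_sum_expand:
  assumes g: "\<And>n. g (n + k) = g n" and "k > 0" "y > 0"
  shows "periodic_dedekind_sum k x y g h =
    (\<Sum>r\<in>{0..<k}. \<Sum>m\<in>{0..<k}. g r * h (- m) *
      of_real (\<Sum>j\<in>{0..<y}. bernoulli_P 1 ((of_int j + of_int r / of_int k) / of_int y) *
        bernoulli_P 1 (of_int m / of_int k + of_int x * ((of_int j + of_int r / of_int k) / of_int y))))"
proof -
  have pos: "real_of_int k > 0" "real_of_int y > 0" using assms by simp_all
  define F where "F = (\<lambda>n. g n * of_real (bernoulli_P 1 (of_int n / of_int (y * k))) *
     periodic_P k 1 (of_int (x * n) / of_int y) h)"
  \<comment> \<open>Adding \<open>y * k\<close> to \<open>n\<close> moves each argument of P_1 by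
    the integer \<open>x\<close>.\<close>
  have perP: "periodic_P k 1 (of_int (x * (n + y * k)) / of_int y) h =
      periodic_P k 1 (of_int (x * n) / of_int y) h" for n
    unfolding periodic_P_def
  proof (intro arg_cong2[of _ _ _ _ "(*)"] refl sum.cong)
    fix m
    show "complex_of_real (bernoulli_P 1 ((of_int m + of_int (x * (n + y * k)) / of_int y) / of_int k)) =
        of_real (bernoulli_P 1 ((of_int m + of_int (x * n) / of_int y) / of_int k))"
      unfolding of_real_eq_iff
      by (rule bernoulli_P_eq[where j = x]) (use pos in \<open>simp add: field_simps\<close>)
  qed
  have "F (n + y * k) = F n" for n
  proof -
    have "bernoulli_P 1 (of_int (n + y * k) / of_int (y * k)) = bernoulli_P 1 (of_int n / of_int (y * k))"
      by (rule bernoulli_P_eq[where j = 1]) (use pos in \<open>simp add: field_simps\<close>)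
    moreover have "g (n + y * k) = g n"
      using periodic_mult[of g, OF g, of n y] by (simp add: mult.commute)
    ultimately show ?thesis by (simp only: F_def perP)
  qed
  hence "periodic_dedekind_sum k x y g h = (\<Sum>r\<in>{0..<k}. \<Sum>j\<in>{0..<y}. F (r + k * j))"
    using sum_split_residues[of F y k] assms by (simp add: periodic_dedekind_sum_def F_def)
  also have "\<dots> = (\<Sum>r\<in>{0..<k}. \<Sum>j\<in>{0..<y}. \<Sum>m\<in>{0..<k}. g r * h (- m) *
      of_real (bernoulli_P 1 ((of_int j + of_int r / of_int k) / of_int y) *
        bernoulli_P 1 (of_int m / of_int k + of_int x * ((of_int j + of_int r / of_int k) / of_int y))))"
  proof (intro sum.cong refl)
    fix r j
    have 1: "of_int (r + k * j) / of_int (y * k) = (of_int j + of_int r / of_int k) / real_of_int y"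
      using pos by (simp add: field_simps)
    have 2: "(of_int m + of_int (x * (r + k * j)) / of_int y) / of_int k =
        of_int m / of_int k + of_int x * ((of_int j + of_int r / of_int k) / real_of_int y)" for m
      using pos by (simp add: field_simps)
    show "F (r + k * j) = (\<Sum>m\<in>{0..<k}. g r * h (- m) *
      of_real (bernoulli_P 1 ((of_int j + of_int r / of_int k) / of_int y) *
        bernoulli_P 1 (of_int m / of_int k + of_int x * ((of_int j + of_int r / of_int k) / of_int y))))"
      unfolding F_def periodic_P_def 1 2 periodic_mult[of g, OF g]
      by (simp add: sum_distrib_left mult_ac)
  qed
  also have "\<dots> = (\<Sum>r\<in>{0..<k}. \<Sum>m\<in>{0..<k}. g r * h (- m) *
      of_real (\<Sum>j\<in>{0..<y}. bernoulli_P 1 ((of_int j + of_int r / of_int k) / of_int y) *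
        bernoulli_P 1 (of_int m / of_int k + of_int x * ((of_int j + of_int r / of_int k) / of_int y))))"
    unfolding of_real_sum sum_distrib_left by (intro sum.cong refl sum.swap)
  finally show ?thesis .
qed

theorem theorem4:
  fixes k b c d :: int and f fstar :: "int \<Rightarrow> complex"
  assumes "k > 0"
    and "\<And>n. f (n + k) = f n"
    and "\<And>n. fstar (n + k) = fstar n"
    and "c > 0" and "d > 0" and "coprime c d"
    and "[d = 0] (mod k)"
    and "[b * c = -1] (mod d)"
  shows "periodic_dedekind_sum k (- c) d (dilate f c) (dilate fstar (- b))
           - periodic_dedekind_sum k d c (dilate fstar b) (dilate f c)
         = periodic_P k 1 0 (dilate fstar (- b)) * periodic_P k 1 0 (dilate f (- c))
           - of_int d / of_int c
               * periodic_bernoulli_number k 0 f * periodic_P k 2 0 (dilate fstar b)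
           - of_int c / of_int d
               * periodic_bernoulli_number k 0 fstar * periodic_P k 2 0 (dilate f c)
           - 1 / (2 * of_int d * of_int c)
               * periodic_bernoulli_number k 0 fstar * periodic_bernoulli_number k 2 f"
proof -
  have k: "real_of_int k > 0" "complex_of_int k \<noteq> 0" using assms(1) by simp_all
  have kd: "k dvd d" using assms(7) by (simp add: cong_0_iff)
  have ck: "coprime c k" using coprime_divisors[OF dvd_refl kd assms(6)] .
  \<comment> \<open>The congruence makes \<open>b\<close> invertible modulo \<open>k\<close>, so
    dilation by \<open>b\<close> preserves sums over a period.\<close>
  have "[b * c = - 1] (mod k)" using assms(8) kd by (rule cong_dvd_modulus)
  hence "coprime (b * c) k"
    using cong_imp_coprime[OF cong_sym, of "b * c" "- 1" k] by simp
  hence bk: "coprime b k" by simp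
  \<comment> \<open>\<open>F\<close> and \<open>G\<close> absorb the dilations; negative dilation
    factors become reflections of \<open>F\<close> and \<open>G\<close>.\<close>
  define F where "F = (\<lambda>r. f (c * r))"
  define G where "G = (\<lambda>m. fstar (b * m))"
  have perF: "F (n + k) = F n" and perG: "G (n + k) = G n" for n
    using periodic_mult[of f, OF assms(2), of "c * n" c]
      periodic_mult[of fstar, OF assms(3), of "b * n" b]
    by (simp_all add: F_def G_def algebra_simps)
  define I where "I = {0..<k}"
  let ?r = "\<lambda>n::int. real_of_int n / of_int k"
  define FP where "FP = (\<lambda>i. \<Sum>r\<in>I. F r * of_real (bernoulli_P i (?r r)))"
  define GP where "GP = (\<lambda>i. \<Sum>m\<in>I. G m * of_real (bernoulli_P i (?r m)))"
  define F0 where "F0 = (\<Sum>r\<in>I. F r)"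
  define G0 where "G0 = (\<Sum>m\<in>I. G m)"
  define FZ where "FZ = (\<Sum>r\<in>I. F r * of_real (bernoulli_P 2 (?r (c * r))))"
  \<comment> \<open>\<open>U\<close> and \<open>V\<close> are the two sums of the reciprocity law as
    functions of the shifts.\<close>
  define U where "U = (\<lambda>x y. \<Sum>n\<in>{0..<d}. bernoulli_P 1 ((of_int n + x) / of_int d)
              * bernoulli_P 1 (y - of_int c * ((of_int n + x) / of_int d)))"
  define V where "V = (\<lambda>x y. \<Sum>l\<in>{0..<c}. bernoulli_P 1 ((of_int l + y) / of_int c)
              * bernoulli_P 1 (of_int d * ((of_int l + y) / of_int c) - x))"
  have V_shift: "V (x + of_int j) y = V x y" for x y j
    unfolding V_def
  proof (intro sum.cong refl arg_cong2[of _ _ _ _ "(*)"])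
    fix l
    show "bernoulli_P 1 (of_int d * ((of_int l + y) / of_int c) - (x + of_int j)) =
        bernoulli_P 1 (of_int d * ((of_int l + y) / of_int c) - x)"
      by (rule bernoulli_P_eq[where j = "- j"]) simp
  qed

  have S1: "periodic_dedekind_sum k (- c) d (dilate f c) (dilate fstar (- b)) =
      (\<Sum>r\<in>I. \<Sum>m\<in>I. F r * G m * of_real (U (?r r) (?r m)))"
    using periodic_dedekind_sum_expand[of F k d "- c" "dilate fstar (- b)", OF perF assms(1,5)]
    by (simp add: U_def dilate_def F_def G_def I_def)
  have "periodic_dedekind_sum k d c (dilate fstar b) (dilate f c) =
      (\<Sum>m\<in>I. \<Sum>r\<in>I. G m * F (- r) * of_real (V (- ?r r) (?r m)))"
    using periodic_dedekind_sum_expand[of G k c d "dilate f c", OF perG assms(1,4)]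
    by (simp add: V_def dilate_def F_def G_def I_def add.commute)
  \<comment> \<open>The substitution of \<open>- r\<close> for \<open>r\<close> modulo
    \<open>k\<close> removes the reflection; \<open>V_shift\<close> supplies the periodicity in
    \<open>r\<close> that it needs.\<close>
  also have "\<dots> = (\<Sum>m\<in>I. \<Sum>r\<in>I. G m * F r * of_real (V (?r r) (?r m)))"
  proof (rule sum.cong[OF refl])
    fix m
    let ?h = "\<lambda>r. G m * F r * complex_of_real (V (?r r) (?r m))"
    have "?h (r + k) = ?h r" for r
      using V_shift[of "?r r" 1 "?r m"] perF k by (simp add: add_divide_distrib)
    from sum_periodic_affine[of ?h, OF this assms(1), of "- 1" 0]
    show "(\<Sum>r\<in>I. G m * F (- r) * of_real (V (- ?r r) (?r m))) = (\<Sum>r\<in>I. ?h r)"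
      by (simp add: I_def)
  qed
  finally have S2: "periodic_dedekind_sum k d c (dilate fstar b) (dilate f c) =
      (\<Sum>r\<in>I. \<Sum>m\<in>I. F r * G m * of_real (V (?r r) (?r m)))"
    by (subst sum.swap) (simp add: mult_ac)

  have "U (?r r) (?r m) - V (?r r) (?r m) =
      bernoulli_P 1 (?r r) * bernoulli_P 1 (?r m) - of_int d / of_int c * bernoulli_P 2 (?r m)
      - of_int c / of_int d * bernoulli_P 2 (?r r)
      - 1 / (of_int c * of_int d) * bernoulli_P 2 (?r (c * r))" if "r \<in> I" "m \<in> I" for r m
  proof -
    \<comment> \<open>With \<open>d = k * e\<close>, the shift \<open>d * (m / k)\<close> is the
      integer \<open>e * m\<close> and disappears from P_2.\<close>
    obtain e where e: "d = k * e" using kd by blast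
    have "bernoulli_P 2 (of_int c * ?r r - of_int d * ?r m) = bernoulli_P 2 (?r (c * r))"
      by (rule bernoulli_P_eq[where j = "- e * m"]) (use k e in \<open>simp add: field_simps\<close>)
    moreover have "0 \<le> ?r r" "?r r < 1" "0 \<le> ?r m" "?r m < 1"
      using that k by (simp_all add: I_def)
    ultimately show ?thesis
      using bernoulli_P_1_reciprocity[OF assms(4-6), of "?r r" "?r m"] by (simp add: U_def V_def)
  qed
  \<comment> \<open>The factors 1 give every term the shape \<open>p r * q m\<close>, so that
    \<open>complex_bilinear_sum\<close> splits all four.\<close>
  hence "periodic_dedekind_sum k (- c) d (dilate f c) (dilate fstar (- b))
           - periodic_dedekind_sum k d c (dilate fstar b) (dilate f c) =
      (\<Sum>r\<in>I. \<Sum>m\<in>I. F r * G m * of_real (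
        bernoulli_P 1 (?r r) * bernoulli_P 1 (?r m) - 1 * (of_int d / of_int c * bernoulli_P 2 (?r m))
        - of_int c / of_int d * bernoulli_P 2 (?r r) * 1
        - 1 / (of_int c * of_int d) * bernoulli_P 2 (?r (c * r)) * 1))"
    unfolding S1 S2 sum_subtractf[symmetric] right_diff_distrib[symmetric] of_real_diff[symmetric]
    by (intro sum.cong refl) simp
  also have "\<dots> = FP 1 * GP 1 - of_int d / of_int c * F0 * GP 2 - of_int c / of_int d * FP 2 * G0
      - 1 / (of_int c * of_int d) * FZ * G0"
    unfolding of_real_diff right_diff_distrib sum_subtractf complex_bilinear_sum
    by (simp add: FP_def GP_def F0_def G0_def FZ_def sum_distrib_left sum_distrib_right mult_ac)
  finally have main: "periodic_dedekind_sum k (- c) d (dilate f c) (dilate fstar (- b))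
           - periodic_dedekind_sum k d c (dilate fstar b) (dilate f c) =
      FP 1 * GP 1 - of_int d / of_int c * F0 * GP 2 - of_int c / of_int d * FP 2 * G0
      - 1 / (of_int c * of_int d) * FZ * G0" .

  \<comment> \<open>Evenness of P_2 cancels the sign that \<open>periodic_P\<close> puts on the
    index of its sequence.\<close>
  have even: "(\<Sum>m\<in>I. H (- m) * complex_of_real (bernoulli_P 2 (?r m))) =
      (\<Sum>m\<in>I. H m * of_real (bernoulli_P 2 (?r m)))" if H: "\<And>n. H (n + k) = H n" for H
  proof -
    let ?h = "\<lambda>m. H m * complex_of_real (bernoulli_P 2 (?r m))"
    have "?h (m + k) = ?h m" for m
      using bernoulli_P_shift[of 2 "?r m" 1] H k by (simp add: add_divide_distrib)
    from sum_periodic_affine[of ?h, OF this assms(1), of "- 1" 0]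
    show ?thesis by (simp add: I_def bernoulli_P_2_minus)
  qed
  \<comment> \<open>For P_1 the signs in \<open>- b\<close> and \<open>- c\<close> already cancel
    that of \<open>periodic_P\<close>, so no reflection is required.\<close>
  have R1: "periodic_P k 1 0 (dilate fstar (- b)) = GP 1" "periodic_P k 1 0 (dilate f (- c)) = FP 1"
    by (simp_all add: periodic_P_def dilate_def GP_def FP_def F_def G_def I_def)
  have R2: "periodic_P k 2 0 (dilate fstar b) = of_int k * GP 2"
    "periodic_P k 2 0 (dilate f c) = of_int k * FP 2"
    using even[of G, OF perG] even[of F, OF perF]
    by (simp_all add: periodic_P_def dilate_def GP_def FP_def F_def G_def I_def)
  have "F0 = (\<Sum>n\<in>{0..<k}. f n)" "G0 = (\<Sum>n\<in>{0..<k}. fstar n)"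
    using sum_periodic_affine[of f, OF assms(2,1) ck, of 0]
      sum_periodic_affine[of fstar, OF assms(3,1) bk, of 0]
    by (simp_all add: F0_def G0_def F_def G_def I_def)
  hence R0: "F0 = of_int k * periodic_bernoulli_number k 0 f"
    "G0 = of_int k * periodic_bernoulli_number k 0 fstar"
    using periodic_bernoulli_number_0[OF assms(1)] by simp_all
  \<comment> \<open>In \<open>FZ\<close> the sequence and the argument of P_2 are both dilated by
    \<open>c\<close>, so the permutation of residues by \<open>c\<close> undoes both at
    once.\<close>
  let ?h = "\<lambda>n. f n * complex_of_real (bernoulli_P 2 (?r n))"
  have "?h (n + k) = ?h n" for n
    using bernoulli_P_shift[of 2 "?r n" 1] assms(2) k by (simp add: add_divide_distrib)
  from sum_periodic_affine[of ?h, OF this assms(1) ck, of 0]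
  have "FZ = (\<Sum>n\<in>I. ?h n)" by (simp add: FZ_def F_def I_def)
  also have "\<dots> = (\<Sum>n\<in>I. f n * of_real (bernoulli_poly 2 (?r n)) / 2)"
  proof (intro sum.cong refl)
    fix n assume "n \<in> I"
    hence "\<lfloor>?r n\<rfloor> = 0" using k by (simp add: I_def floor_eq_iff)
    thus "?h n = f n * of_real (bernoulli_poly 2 (?r n)) / 2" by (simp add: bernoulli_P_def)
  qed
  finally have RZ: "periodic_bernoulli_number k 2 f = 2 * of_int k * FZ"
    using periodic_bernoulli_number_2[OF assms(1), of f]
    by (simp add: I_def mult.commute[of 2] flip: sum_divide_distrib)
  \<comment> \<open>Each factor \<open>k\<close> from \<open>R0\<close> pairs with the
    \<open>k\<close> in \<open>R2\<close> or with the \<open>2 * k\<close> in \<open>RZ\<close>; the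
    latter explains the coefficient 1/(2dc).\<close>
  show ?thesis
    unfolding main R1 R2 RZ R0 by (simp add: mult_ac)
qed
end
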